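(* Let $\epsilon\in(0,1)$ and let $m\geq16/\epsilon$ be an integer. For a dataset $P\subset\mathcal{G}^d$ define, for $1\leq\kappa\leq m$, $$q_P(\kappa)=\max\Big\{0\leq i\leq\min\{\kappa-1,m-\kappa\}:\frac{\mathrm{vol}(D_P(\kappa+i))}{\mathrm{vol}(D_P(\kappa-i))}\geq\frac12\Big\}.$$ The Shifted Exponential Mechanism, which on input $P$ picks $\kappa\in\{1,\dots,m\}$ with probability proportional to $\exp(\frac\epsilon8q_P(\kappa))$, independently picks an integer $X$ with $\Pr[X=i]\propto e^{-\frac\epsilon8|i|}$ (discrete Laplace), and outputs $\kappa+X$, is $\epsilon$-differentially private (over datasets for which all $D_P(j)$, $1\leq j\leq m$, have positive volume).
   Context: $\mathcal{G}\subset[0,1]$ is a grid of granularity $2^{-\upsilon}$. $\mathrm{TD}(y,P)=\min_{u\in\mathbb{S}^{d-1}}|\{p\in P:\langle p,u\rangle\leq\langle y,u\rangle\}|$, $D_P(\kappa)=\{y:\mathrm{TD}(y,P)\geq\kappa\}$, $\mathrm{vol}$ is $d$-dimensional volume. Neighboring datasets: $|P\triangle P'|=1$. A mechanism $\mathcal{M}$ is $\epsilon$-differentially private if $\Pr[\mathcal{M}(P)\in S]\leq e^\epsilon\Pr[\mathcal{M}(P')\in S]$ for all neighboring $P,P'$ and all sets $S$ of outputs. *)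

theory Defs
  imports "HOL-Probability.Probability"
begin

definition grid :: "nat \<Rightarrow> real set" where
  "grid \<upsilon> = {real k / 2 ^ \<upsilon> | k. k \<le> 2 ^ \<upsilon>}"

definition grid_power :: "nat \<Rightarrow> (real ^ 'n) set" where
  "grid_power \<upsilon> = {x. \<forall>i. x $ i \<in> grid \<upsilon>}"

(* For a finite dataset the values range over {0..card P}, so Min is taken over a
   finite nonempty set. *)
definition tukey_depth :: "real ^ 'n \<Rightarrow> (real ^ 'n) set \<Rightarrow> nat" where
  "tukey_depth y P = (MIN u\<in>sphere 0 1. card {p \<in> P. p \<bullet> u \<le> y \<bullet> u})"

definition depth_region :: "(real ^ 'n) set \<Rightarrow> nat \<Rightarrow> (real ^ 'n) set" where
  "depth_region P \<kappa> = {y. tukey_depth y P \<ge> \<kappa>}"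

abbreviation vol :: "(real ^ 'n) set \<Rightarrow> real" where
  "vol A \<equiv> measure lebesgue A"

(* Intended for 1 <= kappa <= m, where the truncated subtractions are exact. *)
definition shift_score :: "nat \<Rightarrow> (real ^ 'n) set \<Rightarrow> nat \<Rightarrow> nat" where
  "shift_score m P \<kappa> =
     Max {i. i \<le> min (\<kappa> - 1) (m - \<kappa>) \<and>
             vol (depth_region P (\<kappa> + i)) / vol (depth_region P (\<kappa> - i)) \<ge> 1 / 2}"

(* The distribution on A with probabilities proportional to w; meaningful when w is
   nonnegative and has a positive finite sum over A, see pmf_proportional below. *)
definition proportional_pmf :: "'a set \<Rightarrow> ('a \<Rightarrow> real) \<Rightarrow> 'a pmf" where
  "proportional_pmf A w =
     embed_pmf (\<lambda>x. if x \<in> A then w x / (\<Sum>\<^sub>\<infinity>y\<in>A. w y) else 0)"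

definition shifted_exp_mechanism :: "real \<Rightarrow> nat \<Rightarrow> (real ^ 'n) set \<Rightarrow> int pmf" where
  "shifted_exp_mechanism \<epsilon> m P =
     map_pmf (\<lambda>(\<kappa>, X). int \<kappa> + X)
       (pair_pmf
          (proportional_pmf {1..m} (\<lambda>\<kappa>. exp (\<epsilon> / 8 * real (shift_score m P \<kappa>))))
          (proportional_pmf UNIV (\<lambda>i. exp (- (\<epsilon> / 8) * \<bar>real_of_int i\<bar>))))"

definition neighboring :: "'a set \<Rightarrow> 'a set \<Rightarrow> bool" where
  "neighboring P P' \<longleftrightarrow> card (sym_diff P P') = 1"

definition differentially_private ::
    "real \<Rightarrow> 'a set set \<Rightarrow> ('a set \<Rightarrow> 'b pmf) \<Rightarrow> bool" where
  "differentially_private \<epsilon> \<D> M \<longleftrightarrow>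
     (\<forall>P\<in>\<D>. \<forall>P'\<in>\<D>. neighboring P P' \<longrightarrow>
        (\<forall>S. measure_pmf.prob (M P) S \<le> exp \<epsilon> * measure_pmf.prob (M P') S))"

lemma pmf_proportional:
  assumes nonneg: "\<And>x. x \<in> A \<Longrightarrow> w x \<ge> 0"
    and summable: "w summable_on A"
    and pos: "(\<Sum>\<^sub>\<infinity>y\<in>A. w y) > 0"
  shows "pmf (proportional_pmf A w) x = (if x \<in> A then w x / (\<Sum>\<^sub>\<infinity>y\<in>A. w y) else 0)"
proof -
  let ?Z = "\<Sum>\<^sub>\<infinity>y\<in>A. w y"
  let ?f = "\<lambda>x. w x / ?Z"
  have f_nonneg: "\<And>x. x \<in> A \<Longrightarrow> ?f x \<ge> 0"
    using nonneg pos by simp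
  have "?f summable_on A"
    using summable_on_cmult_left[OF summable, of "1 / ?Z"] by simp
  then have "(\<lambda>x. norm (?f x)) summable_on A"
    using summable_on_cong[of A "\<lambda>x. norm (?f x)" ?f] nonneg pos by auto
  then have abs: "Infinite_Set_Sum.abs_summable_on ?f A"
    by (simp only: abs_summable_equivalent)
  have "(\<integral>\<^sup>+x. ennreal (if x \<in> A then ?f x else 0) \<partial>count_space UNIV)
      = (\<integral>\<^sup>+x. ennreal (?f x) * indicator A x \<partial>count_space UNIV)"
    by (intro nn_integral_cong) auto
  also have "\<dots> = (\<integral>\<^sup>+x. ennreal (?f x) \<partial>count_space A)"
    by (simp add: nn_integral_count_space_indicator)
  also have "\<dots> = ennreal (infsetsum ?f A)"
    using abs f_nonneg by (rule nn_integral_conv_infsetsum)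
  also have "infsetsum ?f A = infsum ?f A"
    using abs by (rule infsetsum_infsum)
  also have "infsum ?f A = 1"
    using pos infsum_cmult_left'[of w "1 / ?Z" A] by simp
  finally show ?thesis
    unfolding proportional_pmf_def
    by (subst pmf_embed_pmf) (use f_nonneg in auto)
qed

lemma pmf_proportional_finite:
  assumes "finite A" "A \<noteq> {}" "\<And>x. x \<in> A \<Longrightarrow> w x > 0"
  shows "pmf (proportional_pmf A w) x = (if x \<in> A then w x / (\<Sum>y\<in>A. w y) else 0)"
proof -
  have "(\<Sum>y\<in>A. w y) > 0"
    using assms by (simp add: sum_pos)
  then show ?thesis
    using assms by (subst pmf_proportional) (auto intro: less_imp_le summable_on_finite)
qed

lemma summable_on_exp_abs_int:
  fixes c :: real
  assumes "c > 0"
  shows "(\<lambda>i::int. exp (- c * \<bar>real_of_int i\<bar>)) summable_on UNIV"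
proof -
  let ?g = "\<lambda>i::int. exp (- c * \<bar>real_of_int i\<bar>)"
  have "summable (\<lambda>n::nat. exp (- c) ^ n)"
    using assms by (intro summable_geometric) simp
  then have "(\<lambda>n::nat. exp (- c) ^ n) summable_on UNIV"
    by (subst summable_on_UNIV_nonneg_real_iff) auto
  then have *: "(\<lambda>n::nat. exp (- c * real n)) summable_on UNIV"
    by (simp add: exp_of_nat_mult[symmetric] mult.commute)
  have "?g summable_on (range int)"
    using * by (subst summable_on_reindex) (auto simp: o_def)
  moreover have "?g summable_on ((\<lambda>n. - int n) ` UNIV)"
    using * by (subst summable_on_reindex) (auto simp: o_def inj_on_def)
  then have "?g summable_on ((\<lambda>n. - int n) ` UNIV - range int)"
    by (rule summable_on_subset_banach) auto
  ultimately have "?g summable_on (range int \<union> ((\<lambda>n. - int n) ` UNIV - range int))"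
    by (intro summable_on_Un_disjoint) auto
  also have "range int \<union> ((\<lambda>n. - int n) ` UNIV - range int) = UNIV"
  proof -
    have "i \<in> range int \<union> (\<lambda>n. - int n) ` UNIV" for i
      by (cases i rule: int_cases2) auto
    then show ?thesis by auto
  qed
  finally show ?thesis .
qed

lemma pmf_discrete_laplace:
  fixes c :: real
  assumes "c > 0"
  shows "pmf (proportional_pmf UNIV (\<lambda>i::int. exp (- c * \<bar>real_of_int i\<bar>))) j
       = exp (- c * \<bar>real_of_int j\<bar>) / (\<Sum>\<^sub>\<infinity>i. exp (- c * \<bar>real_of_int i\<bar>))"
proof -
  let ?g = "\<lambda>i::int. exp (- c * \<bar>real_of_int i\<bar>)"
  have "sum ?g {0} \<le> infsum ?g UNIV"
    by (rule finite_sum_le_infsum[OF summable_on_exp_abs_int[OF assms]]) auto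
  then have "infsum ?g UNIV > 0" by simp
  then show ?thesis
    using summable_on_exp_abs_int[OF assms] by (subst pmf_proportional) auto
qed

end

theory Submission
  imports Defs
begin

text \<open>
  Adding or removing one point changes every Tukey depth by at most one, so the depth regions of
  neighbouring datasets interleave: \<open>D\<^sub>P(j+1) \<subseteq> D\<^bsub>P'\<^esub>(j)\<close> and vice versa. If \<open>i\<close> is admissible in the
  maximum defining \<open>q\<^sub>P(\<kappa>)\<close>, then interleaving at both \<open>\<kappa> + i\<close> and \<open>\<kappa> - i\<close> makes \<open>i - 1\<close> admissible
  for \<open>q\<^bsub>P'\<^esub>(\<kappa>)\<close>. Hence \<open>q\<close> has sensitivity one and already the choice of \<open>\<kappa>\<close> is
  \<open>\<epsilon>/4\<close>-differentially private; adding the noise \<open>X\<close> is postprocessing.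
\<close>

text \<open>Makes every dataset finite, so that \<open>card\<close> and \<open>MIN\<close> in
  \<open>tukey_depth\<close> have their intended values.\<close>

lemma finite_grid_power: "finite (grid_power \<upsilon> :: (real ^ 'n) set)"
proof -
  have "grid \<upsilon> = (\<lambda>k. real k / 2 ^ \<upsilon>) ` {..2 ^ \<upsilon>}"
    unfolding grid_def by auto
  then have "finite (Pi\<^sub>E (UNIV :: 'n set) (\<lambda>_. grid \<upsilon>))"
    by (intro finite_PiE) auto
  moreover have "grid_power \<upsilon> \<subseteq> vec_lambda ` Pi\<^sub>E (UNIV :: 'n set) (\<lambda>_. grid \<upsilon>)"
  proof
    fix x :: "real ^ 'n"
    assume "x \<in> grid_power \<upsilon>"
    then have "vec_nth x \<in> Pi\<^sub>E UNIV (\<lambda>_. grid \<upsilon>)"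
      by (auto simp: grid_power_def)
    then show "x \<in> vec_lambda ` Pi\<^sub>E UNIV (\<lambda>_. grid \<upsilon>)"
      by (metis image_eqI vec_nth_inverse)
  qed
  ultimately show ?thesis
    by (meson finite_imageI finite_subset)
qed

text \<open>A direction attaining the minimum for \<open>P'\<close> is also a candidate for
  \<open>P\<close>, and its halfspace contains no points of \<open>P\<close> beyond those of
  \<open>P'\<close> and of \<open>P - P'\<close>.\<close>

lemma tukey_depth_le_add_card_Diff:
  fixes P P' :: "(real ^ 'n) set"
  assumes "finite P" "finite P'"
  shows "tukey_depth y P \<le> tukey_depth y P' + card (P - P')"
proof -
  let ?f = "\<lambda>Q u. card {p \<in> Q. p \<bullet> u \<le> y \<bullet> u}"
  \<comment> \<open>The sphere may be infinite, but the counts are bounded by \<open>card Q\<close>,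
    so the minimum is attained.\<close>
  have fin: "finite (?f Q ` sphere 0 1)" if "finite Q" for Q
  proof (rule finite_subset)
    show "?f Q ` sphere 0 1 \<subseteq> {..card Q}"
      using that by (auto intro!: card_mono)
  qed simp
  have "sphere (0 :: real ^ 'n) 1 \<noteq> {}"
    by simp
  then have "tukey_depth y P' \<in> ?f P' ` sphere 0 1"
    unfolding tukey_depth_def by (intro Min_in fin assms) auto
  then obtain u where u: "u \<in> sphere 0 1" "tukey_depth y P' = ?f P' u"
    by auto
  have "tukey_depth y P \<le> ?f P u"
    unfolding tukey_depth_def using u(1) by (intro Min_le fin assms imageI)
  also have "\<dots> \<le> card ({p \<in> P'. p \<bullet> u \<le> y \<bullet> u} \<union> (P - P'))"
    using assms by (intro card_mono) auto
  also have "\<dots> \<le> ?f P' u + card (P - P')"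
    by (rule card_Un_le)
  finally show ?thesis
    using u(2) by simp
qed

lemma depth_region_Suc_subset:
  fixes P P' :: "(real ^ 'n) set"
  assumes "finite P" "finite P'" "card (P - P') \<le> 1"
  shows "depth_region P (Suc j) \<subseteq> depth_region P' j"
proof
  fix y assume "y \<in> depth_region P (Suc j)"
  then show "y \<in> depth_region P' j"
    using tukey_depth_le_add_card_Diff[OF assms(1,2), of y] assms(3)
    by (simp add: depth_region_def)
qed

text \<open>
  The measure of a non-measurable set and of a set of infinite measure is the junk value \<open>0\<close>.
\<close>
lemma measure_pos_imp_fmeasurable:
  assumes "measure M A > 0"
  shows "A \<in> fmeasurable M"
proof (rule fmeasurableI)
  show "A \<in> sets M"
    using assms measure_notin_sets by fastforce
  show "emeasure M A < \<infinity>"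
    using assms measure_eq_emeasure_eq_ennreal[of 0 M A]
    by (auto simp: measure_def less_top[symmetric])
qed

lemma shift_score_le_Suc:
  fixes P P' :: "(real ^ 'n) set"
  assumes fin: "finite P" "finite P'"
    and diff: "card (P - P') \<le> 1" "card (P' - P) \<le> 1"
    and pos: "\<And>j. j \<in> {1..m} \<Longrightarrow> vol (depth_region P j) > 0"
    and pos': "\<And>j. j \<in> {1..m} \<Longrightarrow> vol (depth_region P' j) > 0"
    and \<kappa>: "\<kappa> \<in> {1..m}"
  shows "shift_score m P \<kappa> \<le> shift_score m P' \<kappa> + 1"
proof -
  define good where "good Q = {i. i \<le> min (\<kappa> - 1) (m - \<kappa>) \<and>
    vol (depth_region Q (\<kappa> + i)) / vol (depth_region Q (\<kappa> - i)) \<ge> 1 / 2}" for Q :: "(real ^ 'n) set"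
  have score: "shift_score m Q \<kappa> = Max (good Q)" for Q :: "(real ^ 'n) set"
    by (simp add: shift_score_def good_def)
  have fin_good: "finite (good Q)" for Q
    unfolding good_def by (rule finite_subset[of _ "{..m}"]) auto
  \<comment> \<open>At shift 0 the ratio is 1, as the volume is nonzero; hence the maximum is
    attained.\<close>
  have "0 \<in> good P"
    using pos[OF \<kappa>] by (simp add: good_def)
  then have "Max (good P) \<in> good P"
    using fin_good by (intro Max_in) auto
  moreover define i where "i = Max (good P)"
  ultimately have i: "i \<le> min (\<kappa> - 1) (m - \<kappa>)"
    "vol (depth_region P (\<kappa> + i)) / vol (depth_region P (\<kappa> - i)) \<ge> 1 / 2"
    by (auto simp: good_def)
  show ?thesis
  proof (cases i)
    case 0
    then show ?thesis by (simp add: score i_def)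
  next
    case (Suc k)
    have range: "\<kappa> - i \<in> {1..m}" "\<kappa> - k \<in> {1..m}" "\<kappa> + k \<in> {1..m}" "\<kappa> + i \<in> {1..m}"
      using i(1) \<kappa> Suc by auto
    have meas: "depth_region P j \<in> lmeasurable" "depth_region P' j \<in> lmeasurable"
      if "j \<in> {1..m}" for j
      using pos[OF that] pos'[OF that] by (auto intro: measure_pos_imp_fmeasurable)
    \<comment> \<open>Since \<open>i = Suc k\<close> and \<open>i \<le> \<kappa> - 1\<close>, the
      subtraction is exact and \<open>\<kappa> - k\<close> is the successor of
      \<open>\<kappa> - i\<close>.\<close>
    have "depth_region P' (\<kappa> - k) \<subseteq> depth_region P (\<kappa> - i)"
      using depth_region_Suc_subset[OF fin(2,1) diff(2), of "\<kappa> - i"] i(1) \<kappa> Suc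
      by (simp add: Suc_diff_Suc)
    then have lo: "vol (depth_region P' (\<kappa> - k)) \<le> vol (depth_region P (\<kappa> - i))"
      by (rule measure_mono_fmeasurable[OF _ fmeasurableD]) (rule meas range)+
    have "depth_region P (\<kappa> + i) \<subseteq> depth_region P' (\<kappa> + k)"
      using depth_region_Suc_subset[OF fin diff(1), of "\<kappa> + k"] Suc by simp
    then have hi: "vol (depth_region P (\<kappa> + i)) \<le> vol (depth_region P' (\<kappa> + k))"
      by (rule measure_mono_fmeasurable[OF _ fmeasurableD]) (rule meas range)+
    \<comment> \<open>Passing from \<open>P\<close> with shift \<open>i\<close> to \<open>P'\<close>
      with shift \<open>k\<close> does not decrease the numerator and does not increase the positive
      denominator.\<close>
    have "vol (depth_region P' (\<kappa> + k)) / vol (depth_region P' (\<kappa> - k)) \<ge> 1 / 2"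
      using i(2) lo hi pos[OF range(1)] pos'[OF range(2)] by (simp add: field_simps)
    then have "k \<in> good P'"
      using i(1) Suc by (simp add: good_def)
    then have "k \<le> Max (good P')"
      using fin_good by (intro Max_ge)
    then show ?thesis
      using Suc unfolding score i_def by linarith
  qed
qed

text \<open>One factor \<open>c\<close> comes from the weight of \<open>x\<close>, the other from
  the normalizing sum; the latter uses the reverse comparison of the weights.\<close>

lemma pmf_proportional_ratio_le:
  fixes w w' :: "'a \<Rightarrow> real"
  assumes A: "finite A" "A \<noteq> {}"
    and pos: "\<And>x. x \<in> A \<Longrightarrow> w x > 0" "\<And>x. x \<in> A \<Longrightarrow> w' x > 0"
    and c: "c > 0"
    and le: "\<And>x. x \<in> A \<Longrightarrow> w x \<le> c * w' x" "\<And>x. x \<in> A \<Longrightarrow> w' x \<le> c * w x"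
  shows "pmf (proportional_pmf A w) x \<le> c\<^sup>2 * pmf (proportional_pmf A w') x"
proof (cases "x \<in> A")
  case True
  let ?Z = "\<Sum>y\<in>A. w y" and ?Z' = "\<Sum>y\<in>A. w' y"
  have Z: "?Z > 0" "?Z' > 0"
    using A pos by (auto intro: sum_pos)
  have Z_le: "?Z' \<le> c * ?Z"
    using le(2) by (simp add: sum_distrib_left sum_mono)
  have "w x * ?Z' \<le> (c * w' x) * (c * ?Z)"
    using le(1)[OF True] Z_le pos[OF True] c Z by (intro mult_mono) auto
  then have "w x / ?Z \<le> c\<^sup>2 * (w' x / ?Z')"
    using Z by (simp add: field_simps power2_eq_square)
  then show ?thesis
    using True by (simp add: pmf_proportional_finite[OF A] pos)
qed (simp add: pmf_proportional_finite[OF A] pos)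

text \<open>Postprocessing by a fixed kernel \<open>f\<close>: the probability of \<open>S\<close>
  is the average of the values \<open>f x\<close> gives to \<open>S\<close>, so a pointwise bound on
  the averaging weights carries over.\<close>

lemma prob_bind_pmf_le:
  assumes c: "c \<ge> 0" and le: "\<And>x. pmf M x \<le> c * pmf M' x"
  shows "measure_pmf.prob (bind_pmf M f) S \<le> c * measure_pmf.prob (bind_pmf M' f) S"
proof -
  have "emeasure (bind_pmf M f) S = (\<integral>\<^sup>+x. ennreal (pmf M x) * emeasure (f x) S \<partial>count_space UNIV)"
    by (simp add: nn_integral_measure_pmf)
  also have "\<dots> \<le> (\<integral>\<^sup>+x. ennreal c * (ennreal (pmf M' x) * emeasure (f x) S) \<partial>count_space UNIV)"
    using le c by (intro nn_integral_mono)
      (auto simp: mult.assoc[symmetric] ennreal_mult[symmetric] intro!: mult_right_mono ennreal_leI)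
  also have "\<dots> = ennreal c * emeasure (bind_pmf M' f) S"
    by (simp add: nn_integral_cmult nn_integral_measure_pmf)
  finally show ?thesis
    using c by (simp add: measure_pmf.emeasure_eq_measure ennreal_mult[symmetric])
qed

theorem theorem7p4:
  fixes \<epsilon> :: real and m \<upsilon> :: nat
  assumes "0 < \<epsilon>" and "\<epsilon> < 1"
    and "real m \<ge> 16 / \<epsilon>"
  shows "differentially_private \<epsilon>
           {P :: (real ^ 'n) set. P \<subseteq> grid_power \<upsilon> \<and>
              (\<forall>j\<in>{1..m}. vol (depth_region P j) > 0)}
           (shifted_exp_mechanism \<epsilon> m)"
  unfolding differentially_private_def
proof (intro ballI impI allI)
  fix P P' :: "(real ^ 'n) set" and S :: "int set"
  assume "P \<in> {P. P \<subseteq> grid_power \<upsilon> \<and> (\<forall>j\<in>{1..m}. vol (depth_region P j) > 0)}"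
    and "P' \<in> {P. P \<subseteq> grid_power \<upsilon> \<and> (\<forall>j\<in>{1..m}. vol (depth_region P j) > 0)}"
    and nb: "neighboring P P'"
  then have fin: "finite P" "finite P'"
    and pos: "\<And>j. j \<in> {1..m} \<Longrightarrow> vol (depth_region P j) > 0"
      "\<And>j. j \<in> {1..m} \<Longrightarrow> vol (depth_region P' j) > 0"
    using finite_subset[OF _ finite_grid_power] by auto
  \<comment> \<open>The single differing point lies in exactly one of the two differences.\<close>
  have "card (P - P') + card (P' - P) = 1"
    using nb fin by (subst card_Un_disjoint[symmetric]) (auto simp: neighboring_def)
  then have diff: "card (P - P') \<le> 1" "card (P' - P) \<le> 1"
    by auto
  define w where "w Q \<kappa> = exp (\<epsilon> / 8 * real (shift_score m Q \<kappa>))" for Q :: "(real ^ 'n) set" and \<kappa>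
  have w_le: "w Q \<kappa> \<le> exp (\<epsilon> / 8) * w Q' \<kappa>"
    if "shift_score m Q \<kappa> \<le> shift_score m Q' \<kappa> + 1" for Q Q' \<kappa>
  proof -
    have "real (shift_score m Q \<kappa>) \<le> real (shift_score m Q' \<kappa>) + 1"
      using that by linarith
    from mult_left_mono[OF this, of "\<epsilon> / 8"] show ?thesis
      using \<open>0 < \<epsilon>\<close> by (simp add: w_def exp_add[symmetric] algebra_simps)
  qed
  \<comment> \<open>Ensures that \<open>{1..m}\<close> is nonempty, so that the weights can be
    normalized.\<close>
  have "real m > 0"
    using assms(1,3) by (smt (verit) divide_pos_pos)
  then have "pmf (proportional_pmf {1..m} (w P)) \<kappa>
      \<le> (exp (\<epsilon> / 8))\<^sup>2 * pmf (proportional_pmf {1..m} (w P')) \<kappa>" for \<kappa>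
    using shift_score_le_Suc[OF fin diff pos] shift_score_le_Suc[OF fin(2,1) diff(2,1) pos(2,1)]
    by (intro pmf_proportional_ratio_le w_le) (auto simp: w_def)
  moreover have "(exp (\<epsilon> / 8))\<^sup>2 \<le> exp \<epsilon>"
    using \<open>0 < \<epsilon>\<close> by (simp add: power2_eq_square exp_add[symmetric])
  ultimately have le: "pmf (proportional_pmf {1..m} (w P)) \<kappa>
      \<le> exp \<epsilon> * pmf (proportional_pmf {1..m} (w P')) \<kappa>" for \<kappa>
    by (meson mult_right_mono order_trans pmf_nonneg)
  define noise where "noise = proportional_pmf UNIV (\<lambda>i. exp (- (\<epsilon> / 8) * \<bar>real_of_int i\<bar>))"
  \<comment> \<open>Given \<open>\<kappa>\<close>, the output is a shift of noise whose law is
    independent of the dataset, so both datasets share one kernel.\<close>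
  have mech: "shifted_exp_mechanism \<epsilon> m Q =
      bind_pmf (proportional_pmf {1..m} (w Q)) (\<lambda>\<kappa>. map_pmf (\<lambda>X. int \<kappa> + X) noise)"
    for Q :: "(real ^ 'n) set"
    by (simp add: shifted_exp_mechanism_def w_def[abs_def] noise_def pair_pmf_def map_pmf_def
        bind_assoc_pmf bind_return_pmf)
  show "measure_pmf.prob (shifted_exp_mechanism \<epsilon> m P) S
      \<le> exp \<epsilon> * measure_pmf.prob (shifted_exp_mechanism \<epsilon> m P') S"
    unfolding mech by (intro prob_bind_pmf_le le) simp
qed

end
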